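(* Let $R$ be a ring, $N\in\mathbb{N}$ and $M$ an $N$-complex in $\mathrm{Mod}_R$. Then there exist a semifree $N$-complex $F$ and a morphism $f:F\to M$ of $N$-complexes such that $f$ is an $N$-quasi-isomorphism. Furthermore, $f$ can be chosen surjective and such that the induced maps $\ker(d_F^r)\to\ker(d_M^r)$ are surjective for all $1\le r\le N-1$.
   Context: An $N$-complex in $\mathrm{Mod}_R$ is a $\mathbb{Z}$-indexed diagram $\cdots\to X^{n}\xrightarrow{d_X}X^{n+1}\to\cdots$ of $R$-modules with $d_X^N=0$; morphisms are families $g^i:X^i\to Y^i$ commuting with the differentials. For $1\le r\le N-1$ and $i\in\mathbb{Z}$, $H^i_{(r)}(X):=\ker(d_X^r:X^i\to X^{i+r})/\mathrm{im}(d_X^{N-r}:X^{i-N+r}\to X^i)$. A morphism $f$ is an $N$-quasi-isomorphism if $H^i_{(r)}(f)$ is an isomorphism for all $i\in\mathbb{Z}$ and $1\le r\le N-1$. An $N$-complex $F$ in $\mathrm{Mod}_R$ is semifree if there is a filtration by subcomplexes $0=F_0\subset F_1\subset F_2\subset\cdots$ with $F=\bigcup_{n\in\mathbb{N}}F_n$ such that for all $i\ge1$ the quotient $F_i/F_{i-1}$ is levelwise free (a free $R$-module in each degree) with vanishing differential. *)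

theory Defs
  imports "HOL-Algebra.Module" "HOL-Algebra.QuotRing"
begin

section \<open>Modules over a not necessarily commutative ring\<close>

text \<open>
  The locale \<^locale>\<open>module\<close> of the library assumes a commutative ring.  Here are unital left
  modules over an arbitrary unital ring, on the same records; the multiplication and unit fields of
  the module record carry no meaning.  Right modules are left modules over the opposite ring.
\<close>

locale left_module = R?: ring R + M?: abelian_group M
  for R :: "('r, 'k) ring_scheme" (structure) and M :: "('r, 'm) module" (structure) +
  assumes smult_closed:
      "\<lbrakk>a \<in> carrier R; x \<in> carrier M\<rbrakk> \<Longrightarrow> a \<odot>\<^bsub>M\<^esub> x \<in> carrier M"
    and smult_l_distr:
      "\<lbrakk>a \<in> carrier R; b \<in> carrier R; x \<in> carrier M\<rbrakk> \<Longrightarrow>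
        (a \<oplus>\<^bsub>R\<^esub> b) \<odot>\<^bsub>M\<^esub> x = a \<odot>\<^bsub>M\<^esub> x \<oplus>\<^bsub>M\<^esub> b \<odot>\<^bsub>M\<^esub> x"
    and smult_r_distr:
      "\<lbrakk>a \<in> carrier R; x \<in> carrier M; y \<in> carrier M\<rbrakk> \<Longrightarrow>
        a \<odot>\<^bsub>M\<^esub> (x \<oplus>\<^bsub>M\<^esub> y) = a \<odot>\<^bsub>M\<^esub> x \<oplus>\<^bsub>M\<^esub> a \<odot>\<^bsub>M\<^esub> y"
    and smult_assoc:
      "\<lbrakk>a \<in> carrier R; b \<in> carrier R; x \<in> carrier M\<rbrakk> \<Longrightarrow>
        (a \<otimes>\<^bsub>R\<^esub> b) \<odot>\<^bsub>M\<^esub> x = a \<odot>\<^bsub>M\<^esub> (b \<odot>\<^bsub>M\<^esub> x)"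
    and smult_one: "x \<in> carrier M \<Longrightarrow> \<one>\<^bsub>R\<^esub> \<odot>\<^bsub>M\<^esub> x = x"

lemma module_iff_left_module:
  fixes R :: "('r, 'k) ring_scheme" and M :: "('r, 'm) module"
  shows "module R M \<longleftrightarrow> cring R \<and> left_module R M"
  by (auto simp: module_def module_axioms_def left_module_def left_module_axioms_def
      cring.axioms(1))

definition lin_map :: "('r, 'k) ring_scheme \<Rightarrow> ('r, 'a) module \<Rightarrow> ('r, 'b) module \<Rightarrow> ('a \<Rightarrow> 'b) set"
  where "lin_map R A B = {h \<in> carrier A \<rightarrow> carrier B.
     (\<forall>x\<in>carrier A. \<forall>y\<in>carrier A. h (x \<oplus>\<^bsub>A\<^esub> y) = h x \<oplus>\<^bsub>B\<^esub> h y) \<and>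
     (\<forall>a\<in>carrier R. \<forall>x\<in>carrier A. h (a \<odot>\<^bsub>A\<^esub> x) = a \<odot>\<^bsub>B\<^esub> h x)}"

definition lin_iso :: "('r, 'k) ring_scheme \<Rightarrow> ('r, 'a) module \<Rightarrow> ('r, 'b) module \<Rightarrow> ('a \<Rightarrow> 'b) set"
  where "lin_iso R A B = {h \<in> lin_map R A B. bij_betw h (carrier A) (carrier B)}"

text \<open>
  A basis is a set \<open>B\<close> such that every element is an \<open>R\<close>-linear combination of \<open>B\<close> for exactly one
  finitely supported family of coefficients.
\<close>

definition is_basis :: "('r, 'k) ring_scheme \<Rightarrow> ('r, 'm) module \<Rightarrow> 'm set \<Rightarrow> bool"
  where "is_basis R M B \<longleftrightarrow> B \<subseteq> carrier M \<and>
    (\<forall>x\<in>carrier M. \<exists>!c. c \<in> B \<rightarrow>\<^sub>E carrier R \<and> finite {b \<in> B. c b \<noteq> \<zero>\<^bsub>R\<^esub>} \<and>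
       x = (\<Oplus>\<^bsub>M\<^esub>b\<in>{b \<in> B. c b \<noteq> \<zero>\<^bsub>R\<^esub>}. c b \<odot>\<^bsub>M\<^esub> b))"

definition free_module :: "('r, 'k) ring_scheme \<Rightarrow> ('r, 'm) module \<Rightarrow> bool"
  where "free_module R M \<longleftrightarrow> left_module R M \<and> (\<exists>B. is_basis R M B)"

text \<open>
  The quotient of \<open>M\<close> by a submodule \<open>H\<close>, with cosets as elements.  As for \<^const>\<open>rcoset_mult\<close>, a map
  on cosets is the union of the images of all representatives; for a well-defined map the members
  of this union coincide (see \<open>coset_map_coset\<close> below).
\<close>

definition coset_map :: "('r, 'b) module \<Rightarrow> 'b set \<Rightarrow> ('a \<Rightarrow> 'b) \<Rightarrow> 'a set \<Rightarrow> 'b set"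
  where "coset_map M H g C = (\<Union>x\<in>C. H +>\<^bsub>M\<^esub> g x)"

definition quot_module :: "('r, 'm) module \<Rightarrow> 'm set \<Rightarrow> ('r, 'm set) module"
  where "quot_module M H =
    \<lparr>carrier = a_rcosets\<^bsub>M\<^esub> H, mult = undefined, one = undefined,
     zero = H, add = set_add M, smult = (\<lambda>a. coset_map M H (\<lambda>x. a \<odot>\<^bsub>M\<^esub> x))\<rparr>"

lemma coset_map_coset:
  assumes A: "abelian_group A" and B: "abelian_group B"
    and H: "subgroup H (add_monoid A)" and K: "subgroup K (add_monoid B)"
    and g: "g \<in> carrier A \<rightarrow> carrier B" "g ` H \<subseteq> K"
    and add: "\<And>x y. \<lbrakk>x \<in> carrier A; y \<in> carrier A\<rbrakk> \<Longrightarrow> g (x \<oplus>\<^bsub>A\<^esub> y) = g x \<oplus>\<^bsub>B\<^esub> g y"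
    and x: "x \<in> carrier A"
  shows "coset_map B K g (H +>\<^bsub>A\<^esub> x) = K +>\<^bsub>B\<^esub> g x"
proof -
  interpret A: abelian_group A by fact
  interpret B: abelian_group B by fact
  have HA: "H \<subseteq> carrier A" and KB: "K \<subseteq> carrier B"
    using H K subgroup.subset by fastforce+
  have "K +>\<^bsub>B\<^esub> g (h \<oplus>\<^bsub>A\<^esub> x) = K +>\<^bsub>B\<^esub> g x" if "h \<in> H" for h
  proof -
    have "h \<in> carrier A" "g h \<in> K" using that HA g by auto
    then show ?thesis
      using add[of h x] x g(1) KB B.add.coset_mult_assoc[of K "g h" "g x"]
        B.add.coset_join2[of "g h" K] K by (auto simp: Pi_def subset_iff a_r_coset_def)
  qed
  moreover have "H \<noteq> {}" using H subgroup.one_closed by fastforce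
  ultimately show ?thesis
    unfolding coset_map_def a_r_coset_def' by auto
qed

section \<open>N-complexes\<close>

record ('r, 'm) ncomplex =
  obj :: "int \<Rightarrow> ('r, 'm) module"
  diff :: "int \<Rightarrow> 'm \<Rightarrow> 'm"

text \<open>\<open>diff_pow X i r\<close> is the \<open>r\<close>-fold differential from degree \<open>i\<close> to degree \<open>i + r\<close>.\<close>

primrec diff_pow :: "('r, 'm) ncomplex \<Rightarrow> int \<Rightarrow> nat \<Rightarrow> 'm \<Rightarrow> 'm"
  where
    "diff_pow X i 0 x = x"
  | "diff_pow X i (Suc r) x = diff X (i + int r) (diff_pow X i r x)"

definition n_complex :: "('r, 'k) ring_scheme \<Rightarrow> nat \<Rightarrow> ('r, 'm) ncomplex \<Rightarrow> bool"
  where "n_complex R N X \<longleftrightarrow>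
    (\<forall>i. left_module R (obj X i)) \<and>
    (\<forall>i. diff X i \<in> lin_map R (obj X i) (obj X (i + 1))) \<and>
    (\<forall>i. \<forall>x\<in>carrier (obj X i). diff_pow X i N x = \<zero>\<^bsub>obj X (i + int N)\<^esub>)"

definition complex_hom ::
    "('r, 'k) ring_scheme \<Rightarrow> ('r, 'a) ncomplex \<Rightarrow> ('r, 'b) ncomplex \<Rightarrow> (int \<Rightarrow> 'a \<Rightarrow> 'b) set"
  where "complex_hom R X Y = {g. \<forall>i. g i \<in> lin_map R (obj X i) (obj Y i) \<and>
    (\<forall>x\<in>carrier (obj X i). g (i + 1) (diff X i x) = diff Y i (g i x))}"

definition ker_pow :: "('r, 'm) ncomplex \<Rightarrow> int \<Rightarrow> nat \<Rightarrow> 'm set"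
  where "ker_pow X i r = a_kernel (obj X i) (obj X (i + int r)) (diff_pow X i r)"

definition im_pow :: "('r, 'm) ncomplex \<Rightarrow> int \<Rightarrow> nat \<Rightarrow> 'm set"
  where "im_pow X i s = diff_pow X (i - int s) s ` carrier (obj X (i - int s))"

definition cohom :: "nat \<Rightarrow> ('r, 'm) ncomplex \<Rightarrow> int \<Rightarrow> nat \<Rightarrow> ('r, 'm set) module"
  where "cohom N X i r = quot_module ((obj X i)\<lparr>carrier := ker_pow X i r\<rparr>) (im_pow X i (N - r))"

definition cohom_map ::
    "nat \<Rightarrow> ('r, 'b) ncomplex \<Rightarrow> (int \<Rightarrow> 'a \<Rightarrow> 'b) \<Rightarrow> int \<Rightarrow> nat \<Rightarrow> 'a set \<Rightarrow> 'b set"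
  where "cohom_map N Y f i r = coset_map (obj Y i) (im_pow Y i (N - r)) (f i)"

definition n_quasi_iso :: "('r, 'k) ring_scheme \<Rightarrow> nat \<Rightarrow> ('r, 'a) ncomplex \<Rightarrow> ('r, 'b) ncomplex
    \<Rightarrow> (int \<Rightarrow> 'a \<Rightarrow> 'b) \<Rightarrow> bool"
  where "n_quasi_iso R N X Y f \<longleftrightarrow> f \<in> complex_hom R X Y \<and>
    (\<forall>i. \<forall>r\<in>{1..N - 1}. cohom_map N Y f i r \<in> lin_iso R (cohom N X i r) (cohom N Y i r))"

section \<open>Semifree N-complexes\<close>

definition subcomplex ::
    "('r, 'k) ring_scheme \<Rightarrow> ('r, 'm) ncomplex \<Rightarrow> (int \<Rightarrow> 'm set) \<Rightarrow> bool"
  where "subcomplex R X S \<longleftrightarrow> (\<forall>i. submodule (S i) R (obj X i) \<and> diff X i ` S i \<subseteq> S (i + 1))"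

definition restrict_complex :: "('r, 'm) ncomplex \<Rightarrow> (int \<Rightarrow> 'm set) \<Rightarrow> ('r, 'm) ncomplex"
  where "restrict_complex X S = \<lparr>obj = (\<lambda>i. (obj X i)\<lparr>carrier := S i\<rparr>), diff = diff X\<rparr>"

definition quot_complex :: "('r, 'm) ncomplex \<Rightarrow> (int \<Rightarrow> 'm set) \<Rightarrow> ('r, 'm set) ncomplex"
  where "quot_complex X T =
    \<lparr>obj = (\<lambda>i. quot_module (obj X i) (T i)),
     diff = (\<lambda>i. coset_map (obj X (i + 1)) (T (i + 1)) (diff X i))\<rparr>"

definition free_zero_diff :: "('r, 'k) ring_scheme \<Rightarrow> ('r, 'm) ncomplex \<Rightarrow> bool"
  where "free_zero_diff R X \<longleftrightarrow>
    (\<forall>i. free_module R (obj X i)) \<and>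
    (\<forall>i. \<forall>x\<in>carrier (obj X i). diff X i x = \<zero>\<^bsub>obj X (i + 1)\<^esub>)"

definition semifree :: "('r, 'k) ring_scheme \<Rightarrow> nat \<Rightarrow> ('r, 'm) ncomplex \<Rightarrow> bool"
  where "semifree R N F \<longleftrightarrow> n_complex R N F \<and>
    (\<exists>Fil :: nat \<Rightarrow> int \<Rightarrow> 'm set.
       (\<forall>k. subcomplex R F (Fil k)) \<and>
       (\<forall>i. Fil 0 i = {\<zero>\<^bsub>obj F i\<^esub>}) \<and>
       (\<forall>k i. Fil k i \<subseteq> Fil (Suc k) i) \<and>
       (\<forall>i. carrier (obj F i) = (\<Union>k. Fil k i)) \<and>
       (\<forall>k\<ge>1. free_zero_diff R (quot_complex (restrict_complex F (Fil k)) (Fil (k - 1)))))"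

text \<open>
  HOL cannot quantify existentially over types, so the elements of a semifree resolution need a
  fixed type.  The type below contains, up to bijection, the finitely supported \<open>R\<close>-valued functions
  on any set of generators that can be encoded by finite words in elements of \<open>R\<close>, elements of the
  resolved complex and integers.
\<close>

type_synonym ('r, 'm) resolution_elem = "('r + 'm + int) list \<Rightarrow> 'r"

end

theory Submission
  imports Defs
begin

text \<open>
  The resolution is built by attaching cells of a single kind.  Given a complex \<open>F\<close> with an
  augmentation \<open>f\<close> to \<open>M\<close>, take an element \<open>y\<close> of \<open>M\<close> in degree \<open>i\<close> and an element \<open>w\<close> of \<open>F\<close> in degree
  \<open>i + 1\<close> with \<open>d\<^bsup>N - 1\<^esup> w = 0\<close> and \<open>f w = d y\<close>, and adjoin a free generator \<open>e\<close> with \<open>d e = w\<close> and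
  \<open>f e = y\<close>.  The two conditions say exactly that \<open>d\<^sup>N = 0\<close> persists and that \<open>f\<close> stays a chain map.
  Start with \<open>F = 0\<close>, attach at each stage all cells that the previous stage permits, and take the union
  over all stages.  A cell has its boundary in the previous stage, so successive quotients are free
  with zero differential, and the union is semifree.

  In the union every permitted pair \<open>(y, w)\<close> is realised by a cell (\<open>lift_step\<close>), because \<open>w\<close> has finite
  support and so appears at a finite stage.  Iterating this gives \<open>lift_cycle\<close>: if
  \<open>d\<^sup>r z = 0\<close>, \<open>r + s \<le> N\<close> and \<open>f z = d\<^sup>s y\<close>, then there is \<open>e\<close> with \<open>d\<^sup>s e = z\<close> and \<open>f e = y\<close>.
  For \<open>z = 0\<close> and \<open>r = 0\<close> this says that \<open>f\<close> maps the kernel of \<open>d\<^sup>s\<close> onto the kernel of \<open>d\<^sup>s\<close>;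
  the case \<open>s = N\<close> is surjectivity of \<open>f\<close>.  For \<open>s = N - r\<close> it says that a cycle \<open>z\<close> whose image is a
  boundary is a boundary, which is injectivity on cohomology.

  The free modules consist of finitely supported functions on a set of cells.  Since a cell is
  determined by a value in \<open>M\<close> and a finitely supported function on earlier cells, that is by finite data
  in terms of elements of \<open>R\<close>, elements of \<open>M\<close> and earlier cells, all cells can be named by finite words
  (\<open>cells_named_by_words\<close>), with integers to mark the ends of subwords.
\<close>

section \<open>Submodules, quotients and linear maps\<close>

lemma lin_mapD:
  assumes "h \<in> lin_map R A B"
  shows "x \<in> carrier A \<Longrightarrow> h x \<in> carrier B"
    and "x \<in> carrier A \<Longrightarrow> y \<in> carrier A \<Longrightarrow> h (x \<oplus>\<^bsub>A\<^esub> y) = h x \<oplus>\<^bsub>B\<^esub> h y"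
    and "a \<in> carrier R \<Longrightarrow> x \<in> carrier A \<Longrightarrow> h (a \<odot>\<^bsub>A\<^esub> x) = a \<odot>\<^bsub>B\<^esub> h x"
  using assms by (auto simp: lin_map_def)

lemma lin_mapI:
  assumes "\<And>x. x \<in> carrier A \<Longrightarrow> h x \<in> carrier B"
    and "\<And>x y. x \<in> carrier A \<Longrightarrow> y \<in> carrier A \<Longrightarrow> h (x \<oplus>\<^bsub>A\<^esub> y) = h x \<oplus>\<^bsub>B\<^esub> h y"
    and "\<And>a x. a \<in> carrier R \<Longrightarrow> x \<in> carrier A \<Longrightarrow> h (a \<odot>\<^bsub>A\<^esub> x) = a \<odot>\<^bsub>B\<^esub> h x"
  shows "h \<in> lin_map R A B"
  using assms by (auto simp: lin_map_def)

lemma lin_map_restrict: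
  "h \<in> lin_map R A B \<Longrightarrow> H \<subseteq> carrier A \<Longrightarrow> h \<in> lin_map R (A\<lparr>carrier := H\<rparr>) B"
  by (auto simp: lin_map_def subset_iff)

lemma lin_map_group_hom:
  assumes "left_module R A" "left_module R B" "h \<in> lin_map R A B"
  shows "abelian_group_hom A B h"
proof -
  interpret A: left_module R A by fact
  interpret B: left_module R B by fact
  show ?thesis
    using lin_mapD[OF assms(3)]
    by (intro abelian_group_homI A.abelian_group_axioms B.abelian_group_axioms group_hom.intro
        group_hom_axioms.intro homI A.a_group B.a_group) auto
qed

lemma lin_map_zero:
  assumes "left_module R A" "left_module R B" "h \<in> lin_map R A B"
  shows "h \<zero>\<^bsub>A\<^esub> = \<zero>\<^bsub>B\<^esub>"
  using abelian_group_hom.hom_zero[OF lin_map_group_hom[OF assms]] .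

lemma lin_map_uminus:
  assumes "left_module R A" "left_module R B" "h \<in> lin_map R A B" "x \<in> carrier A"
  shows "h (\<ominus>\<^bsub>A\<^esub> x) = \<ominus>\<^bsub>B\<^esub> h x"
  using abelian_group_hom.hom_a_inv[OF lin_map_group_hom[OF assms(1-3)] assms(4)] .

context left_module
begin

lemma smult_l_null: "x \<in> carrier M \<Longrightarrow> \<zero>\<^bsub>R\<^esub> \<odot>\<^bsub>M\<^esub> x = \<zero>\<^bsub>M\<^esub>"
  using smult_l_distr[of "\<zero>\<^bsub>R\<^esub>" "\<zero>\<^bsub>R\<^esub>" x] smult_closed[of "\<zero>\<^bsub>R\<^esub>" x]
  by (simp add: M.add.l_cancel_one')

lemma smult_r_null: "a \<in> carrier R \<Longrightarrow> a \<odot>\<^bsub>M\<^esub> \<zero>\<^bsub>M\<^esub> = \<zero>\<^bsub>M\<^esub>"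
  using smult_r_distr[of a "\<zero>\<^bsub>M\<^esub>" "\<zero>\<^bsub>M\<^esub>"] smult_closed[of a "\<zero>\<^bsub>M\<^esub>"]
  by (simp add: M.add.l_cancel_one')

lemma smult_finsum:
  "a \<in> carrier R \<Longrightarrow> f \<in> S \<rightarrow> carrier M \<Longrightarrow>
    a \<odot>\<^bsub>M\<^esub> (\<Oplus>\<^bsub>M\<^esub>i\<in>S. f i) = (\<Oplus>\<^bsub>M\<^esub>i\<in>S. a \<odot>\<^bsub>M\<^esub> f i)"
  by (induction S rule: infinite_finite_induct)
    (auto simp: smult_r_null smult_r_distr smult_closed Pi_def M.finsum_insert M.finsum_closed
      M.finsum_infinite)

lemma submodule_abelian_subgroup:
  assumes "submodule H R M"
  shows "abelian_subgroup H M"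
  using assms by (auto intro!: abelian_subgroupI3 additive_subgroup.intro M.abelian_group_axioms
      simp: submodule_def)

lemma submodule_left_module:
  assumes "submodule H R M"
  shows "left_module R (M\<lparr>carrier := H\<rparr>)"
proof -
  interpret H: submodule H R M by fact
  have sub: "H \<subseteq> carrier M" using H.subset by simp
  have "group (add_monoid (M\<lparr>carrier := H\<rparr>))"
    using H.subgroup_is_group[OF M.a_group] by simp
  then have "comm_group (add_monoid (M\<lparr>carrier := H\<rparr>))"
    using sub by (intro group.group_comm_groupI) (auto intro: M.a_comm)
  then have "abelian_group (M\<lparr>carrier := H\<rparr>)"
    by (simp add: abelian_group_def abelian_group_axioms_def abelian_monoid_def comm_group_def)
  then show ?thesis
    using sub H.smult_closed R.ring_axioms
    by (auto simp: left_module_def left_module_axioms_def subset_iff smult_l_distr smult_r_distr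
        smult_assoc smult_one)
qed

lemma coset_eq_iff:
  assumes "submodule H R M" "x \<in> carrier M" "y \<in> carrier M"
  shows "H +>\<^bsub>M\<^esub> x = H +>\<^bsub>M\<^esub> y \<longleftrightarrow> x \<ominus>\<^bsub>M\<^esub> y \<in> H"
proof -
  interpret H: abelian_subgroup H M using submodule_abelian_subgroup assms(1) .
  show ?thesis
    using H.a_rcos_module[OF assms(3,2)] H.a_repr_independence'[OF _ assms(3), of x]
      H.a_repr_independenceD[OF assms(2), of y] unfolding a_minus_def by metis
qed

lemma coset_eq_self_iff:
  assumes "submodule H R M" "x \<in> carrier M"
  shows "H +>\<^bsub>M\<^esub> x = H \<longleftrightarrow> x \<in> H"
proof -
  interpret H: abelian_subgroup H M using submodule_abelian_subgroup assms(1) .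
  show ?thesis
    using assms H.a_rcos_const[of x] H.a_rcos_self[of x] by auto
qed

end

lemma coset_map_lin:
  assumes A: "left_module R A" and B: "left_module R B"
    and H: "submodule H R A" and K: "submodule K R B"
    and g: "g \<in> lin_map R A B" "g ` H \<subseteq> K" and x: "x \<in> carrier A"
  shows "coset_map B K g (H +>\<^bsub>A\<^esub> x) = K +>\<^bsub>B\<^esub> g x"
  using assms lin_mapD[OF g(1)]
  by (intro coset_map_coset) (auto simp: left_module_def submodule_def)

lemma quot_module_simps:
  "carrier (quot_module M H) = (\<lambda>x. H +>\<^bsub>M\<^esub> x) ` carrier M"
  "zero (quot_module M H) = H"
  by (auto simp: quot_module_def A_RCOSETS_def')

context left_module
begin

lemma quot_add:
  assumes "submodule H R M" "x \<in> carrier M" "y \<in> carrier M"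
  shows "(H +>\<^bsub>M\<^esub> x) \<oplus>\<^bsub>quot_module M H\<^esub> (H +>\<^bsub>M\<^esub> y) = H +>\<^bsub>M\<^esub> (x \<oplus>\<^bsub>M\<^esub> y)"
  using abelian_subgroup.a_rcos_sum[OF submodule_abelian_subgroup[OF assms(1)] assms(2,3)]
  by (simp add: quot_module_def)

lemma quot_smult:
  assumes "submodule H R M" "a \<in> carrier R" "x \<in> carrier M"
  shows "a \<odot>\<^bsub>quot_module M H\<^esub> (H +>\<^bsub>M\<^esub> x) = H +>\<^bsub>M\<^esub> (a \<odot>\<^bsub>M\<^esub> x)"
proof -
  have "coset_map M H (\<lambda>x. a \<odot>\<^bsub>M\<^esub> x) (H +>\<^bsub>M\<^esub> x) = H +>\<^bsub>M\<^esub> (a \<odot>\<^bsub>M\<^esub> x)"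
    using assms submodule.smult_closed[OF assms(1)]
    by (intro coset_map_coset M.abelian_group_axioms)
      (auto simp: smult_r_distr smult_closed submodule_def)
  then show ?thesis by (simp add: quot_module_def)
qed

lemma quot_left_module:
  assumes H: "submodule H R M"
  shows "left_module R (quot_module M H)"
proof -
  interpret H: abelian_subgroup H M using submodule_abelian_subgroup H .
  interpret Q: comm_group "M A_Mod H" by (rule H.a_factorgroup_is_comm_group)
  have "abelian_group (quot_module M H)"
    using Q.m_closed Q.m_assoc Q.m_comm Q.l_one Q.one_closed Q.l_inv_ex
    by (intro abelian_groupI) (simp_all add: A_FactGroup_def' quot_module_def)
  moreover have "left_module_axioms R (quot_module M H)"
    using H by unfold_locales
      (auto simp: quot_module_simps quot_smult quot_add smult_closed smult_l_distr smult_r_distr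
        smult_assoc smult_one)
  ultimately show ?thesis
    using R.ring_axioms by (simp add: left_module_def)
qed

lemma quot_proj_lin:
  assumes H: "submodule H R M"
  shows "(\<lambda>x. H +>\<^bsub>M\<^esub> x) \<in> lin_map R M (quot_module M H)"
  using H by (intro lin_mapI) (auto simp: quot_module_simps quot_smult quot_add)

end

text \<open>
  A form of the first isomorphism theorem: the induced map is well defined because \<open>H\<close> maps into \<open>K\<close>,
  and injective because nothing outside \<open>H\<close> does.
\<close>

lemma coset_map_lin_iso:
  assumes A: "left_module R A" and B: "left_module R B"
    and H: "submodule H R A" and K: "submodule K R B"
    and g: "g \<in> lin_map R A B" and surj: "g ` carrier A = carrier B"
    and HK: "\<And>x. x \<in> carrier A \<Longrightarrow> g x \<in> K \<longleftrightarrow> x \<in> H"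
  shows "coset_map B K g \<in> lin_iso R (quot_module A H) (quot_module B K)"
proof -
  interpret A: left_module R A by fact
  interpret B: left_module R B by fact
  interpret H: submodule H R A by fact
  have gH: "g ` H \<subseteq> K" using HK H.subset by auto
  note cm = coset_map_lin[OF A B H K g gH]
  note gD = lin_mapD[OF g]
  have "coset_map B K g \<in> lin_map R (quot_module A H) (quot_module B K)"
    by (intro lin_mapI)
      (auto simp: quot_module_simps cm A.quot_add[OF H] A.quot_smult[OF H] B.quot_add[OF K]
        B.quot_smult[OF K] gD A.smult_closed)
  moreover have "inj_on (coset_map B K g) (carrier (quot_module A H))"
  proof (rule inj_onI)
    fix X Y assume "X \<in> carrier (quot_module A H)" "Y \<in> carrier (quot_module A H)"
      and eq: "coset_map B K g X = coset_map B K g Y"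
    then obtain x y where xy: "x \<in> carrier A" "y \<in> carrier A" "X = H +>\<^bsub>A\<^esub> x" "Y = H +>\<^bsub>A\<^esub> y"
      by (auto simp: quot_module_simps)
    then have "g x \<ominus>\<^bsub>B\<^esub> g y \<in> K"
      using eq B.coset_eq_iff[OF K] by (simp add: cm gD)
    then have "g (x \<ominus>\<^bsub>A\<^esub> y) \<in> K"
      using xy by (simp add: a_minus_def gD lin_map_uminus[OF A B g])
    then have "x \<ominus>\<^bsub>A\<^esub> y \<in> H" using HK xy by simp
    then show "X = Y" using A.coset_eq_iff[OF H] xy by simp
  qed
  moreover have "coset_map B K g ` carrier (quot_module A H) = carrier (quot_module B K)"
  proof -
    have "coset_map B K g ` carrier (quot_module A H) = (\<lambda>x. K +>\<^bsub>B\<^esub> g x) ` carrier A"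
      unfolding quot_module_simps image_image by (intro image_cong) (simp_all add: cm)
    also have "\<dots> = (\<lambda>y. K +>\<^bsub>B\<^esub> y) ` g ` carrier A" by (simp add: image_image)
    finally show ?thesis by (simp add: surj quot_module_simps)
  qed
  ultimately show ?thesis by (simp add: lin_iso_def bij_betw_def)
qed

lemma lin_map_comp:
  "f \<in> lin_map R A B \<Longrightarrow> g \<in> lin_map R B C \<Longrightarrow> (\<lambda>x. g (f x)) \<in> lin_map R A C"
  by (simp add: lin_map_def Pi_iff)

lemma lin_map_const_zero:
  assumes "left_module R B"
  shows "(\<lambda>_. \<zero>\<^bsub>B\<^esub>) \<in> lin_map R A B"
proof -
  interpret B: left_module R B by fact
  show ?thesis by (intro lin_mapI) (auto simp: B.smult_r_null)
qed

lemma submodule_zero: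
  "submodule H R M \<Longrightarrow> \<zero>\<^bsub>M\<^esub> \<in> H"
  using subgroup.one_closed by (fastforce simp: submodule_def)

lemma submodule_add:
  "submodule H R M \<Longrightarrow> x \<in> H \<Longrightarrow> y \<in> H \<Longrightarrow> x \<oplus>\<^bsub>M\<^esub> y \<in> H"
  using subgroup.m_closed by (fastforce simp: submodule_def)

lemma (in left_module) submoduleI:
  assumes sub: "H \<subseteq> carrier M" and zero: "\<zero>\<^bsub>M\<^esub> \<in> H"
    and add: "\<And>x y. x \<in> H \<Longrightarrow> y \<in> H \<Longrightarrow> x \<oplus>\<^bsub>M\<^esub> y \<in> H"
    and smult: "\<And>a x. a \<in> carrier R \<Longrightarrow> x \<in> H \<Longrightarrow> a \<odot>\<^bsub>M\<^esub> x \<in> H"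
  shows "submodule H R M"
proof (intro submodule.intro submodule_axioms.intro M.add.subgroupI)
  fix x assume x: "x \<in> H"
  then have xM: "x \<in> carrier M" using sub by auto
  have "(\<ominus>\<^bsub>R\<^esub> \<one>\<^bsub>R\<^esub>) \<odot>\<^bsub>M\<^esub> x \<oplus>\<^bsub>M\<^esub> x = \<zero>\<^bsub>M\<^esub>"
    using smult_l_distr[of "\<ominus>\<^bsub>R\<^esub> \<one>\<^bsub>R\<^esub>" "\<one>\<^bsub>R\<^esub>" x] xM
    by (simp add: smult_one smult_l_null R.l_neg)
  then have "\<ominus>\<^bsub>M\<^esub> x = (\<ominus>\<^bsub>R\<^esub> \<one>\<^bsub>R\<^esub>) \<odot>\<^bsub>M\<^esub> x"
    using xM by (intro M.minus_equality smult_closed) auto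
  then show "\<ominus>\<^bsub>M\<^esub> x \<in> H" using smult[OF _ x, of "\<ominus>\<^bsub>R\<^esub> \<one>\<^bsub>R\<^esub>"] by simp
qed (use assms in auto)

lemma lin_map_kernel_submodule:
  assumes A: "left_module R A" and B: "left_module R B" and h: "h \<in> lin_map R A B"
  shows "submodule (a_kernel A B h) R A"
proof -
  interpret A: left_module R A by fact
  interpret B: left_module R B by fact
  show ?thesis
    using lin_mapD[OF h] lin_map_zero[OF A B h]
    by (intro A.submoduleI) (auto simp: a_kernel_def' A.smult_closed B.smult_r_null)
qed

lemma lin_map_image_submodule:
  assumes A: "left_module R A" and B: "left_module R B" and h: "h \<in> lin_map R A B"
  shows "submodule (h ` carrier A) R B"
proof -
  interpret A: left_module R A by fact
  interpret B: left_module R B by fact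
  note hD = lin_mapD[OF h]
  show ?thesis
  proof (rule B.submoduleI)
    show "\<zero>\<^bsub>B\<^esub> \<in> h ` carrier A"
      using lin_map_zero[OF A B h] by (metis A.zero_closed imageI)
    show "x \<oplus>\<^bsub>B\<^esub> y \<in> h ` carrier A" if "x \<in> h ` carrier A" "y \<in> h ` carrier A" for x y
      using that by (auto simp: hD(2)[symmetric])
    show "a \<odot>\<^bsub>B\<^esub> x \<in> h ` carrier A" if "a \<in> carrier R" "x \<in> h ` carrier A" for a x
      using that by (auto simp: hD(3)[symmetric] intro!: imageI A.smult_closed)
  qed (use hD in auto)
qed

lemma submodule_of_submodule:
  assumes "left_module R M" "submodule H R M" "submodule K R M" "H \<subseteq> K"
  shows "submodule H R (M\<lparr>carrier := K\<rparr>)"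
proof -
  interpret M: left_module R M by fact
  have "subgroup H (add_monoid (M\<lparr>carrier := K\<rparr>))"
    using M.add.subgroup_incl[of H K] assms by (simp add: submodule_def)
  then show ?thesis
    using assms(2) by (simp add: submodule_def submodule_axioms_def)
qed

lemma coset_map_restrict [simp]: "coset_map (M\<lparr>carrier := K\<rparr>) H g = coset_map M H g"
  by (simp add: coset_map_def a_r_coset_def' fun_eq_iff)

section \<open>Free modules of finitely supported functions\<close>

text \<open>
  The generating set \<open>S\<close> only bounds the supports and enters the carrier alone.  Hence the modules for
  all subsets of one type of generators have the same operations, and \<open>T \<subseteq> S\<close> gives an honest submodule
  rather than an embedding.
\<close>

definition fin_supp_module :: "('r, 'k) ring_scheme \<Rightarrow> 'g set \<Rightarrow> ('r, 'g \<Rightarrow> 'r) module"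
  where "fin_supp_module R S =
    \<lparr>carrier = {c. (\<forall>g. c g \<in> carrier R) \<and> finite {g. c g \<noteq> \<zero>\<^bsub>R\<^esub>} \<and> {g. c g \<noteq> \<zero>\<^bsub>R\<^esub>} \<subseteq> S},
     mult = undefined, one = undefined,
     zero = (\<lambda>_. \<zero>\<^bsub>R\<^esub>), add = (\<lambda>c d g. c g \<oplus>\<^bsub>R\<^esub> d g), smult = (\<lambda>a c g. a \<otimes>\<^bsub>R\<^esub> c g)\<rparr>"

definition single :: "('r, 'k) ring_scheme \<Rightarrow> 'g \<Rightarrow> 'g \<Rightarrow> 'r"
  where "single R g = (\<lambda>h. if h = g then \<one>\<^bsub>R\<^esub> else \<zero>\<^bsub>R\<^esub>)"

text \<open>
  The linear map that sends the generator \<open>g\<close> to \<open>v g\<close>.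
\<close>

definition lin_ext :: "('r, 'k) ring_scheme \<Rightarrow> ('r, 'm) module \<Rightarrow> ('g \<Rightarrow> 'm) \<Rightarrow> ('g \<Rightarrow> 'r) \<Rightarrow> 'm"
  where "lin_ext R M v c = (\<Oplus>\<^bsub>M\<^esub>g\<in>{g. c g \<noteq> \<zero>\<^bsub>R\<^esub>}. c g \<odot>\<^bsub>M\<^esub> v g)"

lemma fin_supp_module_simps [simp]:
  "zero (fin_supp_module R S) = (\<lambda>_. \<zero>\<^bsub>R\<^esub>)"
  "add (fin_supp_module R S) = (\<lambda>c d g. c g \<oplus>\<^bsub>R\<^esub> d g)"
  "smult (fin_supp_module R S) = (\<lambda>a c g. a \<otimes>\<^bsub>R\<^esub> c g)"
  by (simp_all add: fin_supp_module_def)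

lemma fin_supp_module_restrict [simp]:
  "(fin_supp_module R S)\<lparr>carrier := carrier (fin_supp_module R T)\<rparr> = fin_supp_module R T"
  by (simp add: fin_supp_module_def)

lemma fin_supp_carrier:
  "c \<in> carrier (fin_supp_module R S) \<longleftrightarrow>
    (\<forall>g. c g \<in> carrier R) \<and> finite {g. c g \<noteq> \<zero>\<^bsub>R\<^esub>} \<and> (\<forall>g. g \<notin> S \<longrightarrow> c g = \<zero>\<^bsub>R\<^esub>)"
  by (auto simp: fin_supp_module_def)

lemma fin_supp_mono:
  "S \<subseteq> T \<Longrightarrow> carrier (fin_supp_module R S) \<subseteq> carrier (fin_supp_module R T)"
  unfolding subset_iff fin_supp_carrier by blast

context ring
begin

lemma fin_supp_add_closed:
  assumes "c \<in> carrier (fin_supp_module R S)" "d \<in> carrier (fin_supp_module R S)"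
  shows "(\<lambda>g. c g \<oplus> d g) \<in> carrier (fin_supp_module R S)"
proof -
  have "{g. c g \<oplus> d g \<noteq> \<zero>} \<subseteq> {g. c g \<noteq> \<zero>} \<union> {g. d g \<noteq> \<zero>}" by auto
  then show ?thesis
    using assms by (auto simp: fin_supp_carrier intro: finite_subset)
qed

lemma fin_supp_smult_closed:
  assumes "a \<in> carrier R" "c \<in> carrier (fin_supp_module R S)"
  shows "(\<lambda>g. a \<otimes> c g) \<in> carrier (fin_supp_module R S)"
proof -
  have "{g. a \<otimes> c g \<noteq> \<zero>} \<subseteq> {g. c g \<noteq> \<zero>}" using assms by auto
  then show ?thesis
    using assms by (auto simp: fin_supp_carrier intro: finite_subset)
qed

lemma fin_supp_zero: "(\<lambda>_. \<zero>) \<in> carrier (fin_supp_module R S)"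
  by (simp add: fin_supp_carrier)

lemma fin_supp_left_module: "left_module R (fin_supp_module R S)"
proof -
  have "abelian_group (fin_supp_module R S)"
  proof (rule abelian_groupI)
    fix c assume c: "c \<in> carrier (fin_supp_module R S)"
    have "(\<lambda>g. (\<ominus> \<one>) \<otimes> c g) \<in> carrier (fin_supp_module R S)"
      using c by (intro fin_supp_smult_closed) auto
    moreover have "(\<lambda>g. (\<ominus> \<one>) \<otimes> c g \<oplus> c g) = (\<lambda>_. \<zero>)"
      using c by (auto simp: fin_supp_carrier l_minus l_neg)
    ultimately show "\<exists>y\<in>carrier (fin_supp_module R S).
        y \<oplus>\<^bsub>fin_supp_module R S\<^esub> c = \<zero>\<^bsub>fin_supp_module R S\<^esub>"
      by (auto simp: fun_eq_iff)
  qed (auto simp: fin_supp_add_closed fin_supp_zero, auto simp: fin_supp_carrier a_ac)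
  then show ?thesis
    by (auto simp: left_module_def left_module_axioms_def ring_axioms fin_supp_smult_closed)
      (auto simp: fin_supp_carrier l_distr r_distr m_assoc)
qed

lemma fin_supp_submodule:
  assumes "T \<subseteq> S"
  shows "submodule (carrier (fin_supp_module R T)) R (fin_supp_module R S)"
proof -
  interpret S: left_module R "fin_supp_module R S" by (rule fin_supp_left_module)
  interpret T: left_module R "fin_supp_module R T" by (rule fin_supp_left_module)
  have sub: "carrier (fin_supp_module R T) \<subseteq> carrier (fin_supp_module R S)"
    using fin_supp_mono assms by blast
  show ?thesis
  proof (intro submodule.intro submodule_axioms.intro S.add.subgroupI)
    fix c assume c: "c \<in> carrier (fin_supp_module R T)"
    have "\<ominus>\<^bsub>fin_supp_module R S\<^esub> c = \<ominus>\<^bsub>fin_supp_module R T\<^esub> c"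
      using c sub T.l_neg[OF c] by (intro S.minus_equality) auto
    then show "\<ominus>\<^bsub>fin_supp_module R S\<^esub> c \<in> carrier (fin_supp_module R T)"
      using T.a_inv_closed[OF c] by simp
  qed (use sub T.a_closed T.zero_closed T.smult_closed in auto)
qed

lemma single_closed: "g \<in> S \<Longrightarrow> single R g \<in> carrier (fin_supp_module R S)"
  by (auto simp: fin_supp_carrier single_def split: if_splits)

lemma fin_supp_induct [consumes 1, case_names zero add]:
  assumes "c \<in> carrier (fin_supp_module R S)"
    and "P (\<lambda>_. \<zero>)"
    and step: "\<And>a g c. \<lbrakk>a \<in> carrier R; g \<in> S; c \<in> carrier (fin_supp_module R S); P c\<rbrakk> \<Longrightarrow>
      P (\<lambda>h. a \<otimes> single R g h \<oplus> c h)"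
  shows "P c"
proof -
  have "finite {g. c g \<noteq> \<zero>}" using assms(1) by (simp add: fin_supp_carrier)
  then have "\<forall>c. {g. c g \<noteq> \<zero>} = A \<longrightarrow> c \<in> carrier (fin_supp_module R S) \<longrightarrow> P c"
    if "A = {g. c g \<noteq> \<zero>}" for A
    unfolding that[symmetric]
  proof (induction A rule: finite_induct)
    case empty
    then show ?case using assms(2) by (auto simp: fun_eq_iff)
  next
    case (insert g A)
    show ?case
    proof (intro allI impI)
      fix c assume c: "{g. c g \<noteq> \<zero>} = insert g A" "c \<in> carrier (fin_supp_module R S)"
      define d where "d = c(g := \<zero>)"
      have dA: "{g. d g \<noteq> \<zero>} = A" using c(1) insert.hyps(2) by (auto simp: d_def)
      then have d: "d \<in> carrier (fin_supp_module R S)"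
        using c insert.hyps(1) by (auto simp: fin_supp_carrier d_def)
      then have "P d" using insert.IH dA by blast
      then have "P (\<lambda>h. c g \<otimes> single R g h \<oplus> d h)"
        using d c by (intro step) (auto simp: fin_supp_carrier)
      moreover have "(\<lambda>h. c g \<otimes> single R g h \<oplus> d h) = c"
        using c by (auto simp: d_def single_def fin_supp_carrier)
      ultimately show "P c" by simp
    qed
  qed
  then show ?thesis using assms(1) by blast
qed

lemma lin_map_eq_on_singles:
  assumes M: "left_module R M" and f: "f \<in> lin_map R (fin_supp_module R S) M"
    and g: "g \<in> lin_map R (fin_supp_module R S) M"
    and eq: "\<And>x. x \<in> S \<Longrightarrow> f (single R x) = g (single R x)"
    and c: "c \<in> carrier (fin_supp_module R S)"
  shows "f c = g c"
  using c
proof (induction rule: fin_supp_induct)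
  case zero
  show ?case
    using lin_map_zero[OF fin_supp_left_module M f] lin_map_zero[OF fin_supp_left_module M g]
    by simp
next
  case (add a x c)
  have s: "single R x \<in> carrier (fin_supp_module R S)" by (rule single_closed[OF add(2)])
  have expand: "h (\<lambda>y. a \<otimes> single R x y \<oplus> c y) = a \<odot>\<^bsub>M\<^esub> h (single R x) \<oplus>\<^bsub>M\<^esub> h c"
    if h: "h \<in> lin_map R (fin_supp_module R S) M" for h
    using lin_mapD(2)[OF h fin_supp_smult_closed[OF add(1) s] add(3)] lin_mapD(3)[OF h add(1) s]
    by simp
  show ?case using expand[OF f] expand[OF g] eq[OF add(2)] add(4) by simp
qed

end

context left_module
begin

lemma lin_ext_superset:
  assumes "finite A" "{g. c g \<noteq> \<zero>\<^bsub>R\<^esub>} \<subseteq> A" "\<And>g. c g \<in> carrier R" "\<And>g. g \<in> A \<Longrightarrow> v g \<in> carrier M"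
  shows "lin_ext R M v c = (\<Oplus>\<^bsub>M\<^esub>g\<in>A. c g \<odot>\<^bsub>M\<^esub> v g)"
  unfolding lin_ext_def using assms
  by (intro M.add.finprod_mono_neutral_cong_left) (auto simp: smult_l_null smult_closed)

lemma lin_ext_lin:
  assumes v: "\<And>g. g \<in> S \<Longrightarrow> v g \<in> carrier M"
  shows "lin_ext R M v \<in> lin_map R (fin_supp_module R S) M"
proof (rule lin_mapI)
  fix c assume c: "c \<in> carrier (fin_supp_module R S)"
  then show "lin_ext R M v c \<in> carrier M"
    unfolding lin_ext_def using v
    by (intro M.finsum_closed) (auto simp: fin_supp_carrier intro!: smult_closed)
  have vc: "v g \<in> carrier M" if "c g \<noteq> \<zero>\<^bsub>R\<^esub>" for g
    using that c v[of g] by (auto simp: fin_supp_carrier)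
  fix a assume a: "a \<in> carrier R"
  have "lin_ext R M v (\<lambda>g. a \<otimes>\<^bsub>R\<^esub> c g) = (\<Oplus>\<^bsub>M\<^esub>g\<in>{g. c g \<noteq> \<zero>\<^bsub>R\<^esub>}. (a \<otimes>\<^bsub>R\<^esub> c g) \<odot>\<^bsub>M\<^esub> v g)"
    using a c v by (intro lin_ext_superset) (auto simp: fin_supp_carrier)
  also have "\<dots> = (\<Oplus>\<^bsub>M\<^esub>g\<in>{g. c g \<noteq> \<zero>\<^bsub>R\<^esub>}. a \<odot>\<^bsub>M\<^esub> (c g \<odot>\<^bsub>M\<^esub> v g))"
    using a c v by (intro M.finsum_cong') (auto simp: fin_supp_carrier smult_assoc vc intro!: smult_closed)
  also have "\<dots> = a \<odot>\<^bsub>M\<^esub> lin_ext R M v c"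
    unfolding lin_ext_def using a c v
    by (intro smult_finsum[symmetric]) (auto simp: fin_supp_carrier intro!: smult_closed)
  finally show "lin_ext R M v (a \<odot>\<^bsub>fin_supp_module R S\<^esub> c) = a \<odot>\<^bsub>M\<^esub> lin_ext R M v c" by simp
next
  fix c d assume c: "c \<in> carrier (fin_supp_module R S)" and d: "d \<in> carrier (fin_supp_module R S)"
  define A where "A = {g. c g \<noteq> \<zero>\<^bsub>R\<^esub>} \<union> {g. d g \<noteq> \<zero>\<^bsub>R\<^esub>}"
  have A: "finite A" "\<And>g. g \<in> A \<Longrightarrow> v g \<in> carrier M" "\<And>g. c g \<in> carrier R" "\<And>g. d g \<in> carrier R"
    using c d v unfolding A_def fin_supp_carrier by (blast, blast, blast, blast)
  have "lin_ext R M v (\<lambda>g. c g \<oplus>\<^bsub>R\<^esub> d g) = (\<Oplus>\<^bsub>M\<^esub>g\<in>A. (c g \<oplus>\<^bsub>R\<^esub> d g) \<odot>\<^bsub>M\<^esub> v g)"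
    using A by (intro lin_ext_superset) (auto simp: A_def)
  also have "\<dots> = (\<Oplus>\<^bsub>M\<^esub>g\<in>A. c g \<odot>\<^bsub>M\<^esub> v g \<oplus>\<^bsub>M\<^esub> d g \<odot>\<^bsub>M\<^esub> v g)"
    using A by (intro M.finsum_cong') (auto simp: smult_l_distr intro!: smult_closed M.a_closed)
  also have "\<dots> = (\<Oplus>\<^bsub>M\<^esub>g\<in>A. c g \<odot>\<^bsub>M\<^esub> v g) \<oplus>\<^bsub>M\<^esub> (\<Oplus>\<^bsub>M\<^esub>g\<in>A. d g \<odot>\<^bsub>M\<^esub> v g)"
    using A by (intro M.finsum_addf) (auto intro!: smult_closed)
  also have "\<dots> = lin_ext R M v c \<oplus>\<^bsub>M\<^esub> lin_ext R M v d"
    using A lin_ext_superset[of A c v] lin_ext_superset[of A d v] by (auto simp: A_def)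
  finally show "lin_ext R M v (c \<oplus>\<^bsub>fin_supp_module R S\<^esub> d) = lin_ext R M v c \<oplus>\<^bsub>M\<^esub> lin_ext R M v d"
    by simp
qed

lemma lin_ext_single:
  assumes "v g \<in> carrier M"
  shows "lin_ext R M v (single R g) = v g"
proof -
  have "lin_ext R M v (single R g) = (\<Oplus>\<^bsub>M\<^esub>h\<in>{g}. single R g h \<odot>\<^bsub>M\<^esub> v h)"
    using assms by (intro lin_ext_superset) (auto simp: single_def)
  then show ?thesis using assms by (simp add: single_def smult_one)
qed

lemma lin_map_eq_lin_ext:
  assumes "h \<in> lin_map R (fin_supp_module R S) M" "c \<in> carrier (fin_supp_module R S)"
  shows "h c = lin_ext R M (\<lambda>g. h (single R g)) c"
proof (rule R.lin_map_eq_on_singles[OF left_module_axioms assms(1) _ _ assms(2)])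
  have v: "h (single R g) \<in> carrier M" if "g \<in> S" for g
    by (rule lin_mapD(1)[OF assms(1) R.single_closed[OF that]])
  then show "lin_ext R M (\<lambda>g. h (single R g)) \<in> lin_map R (fin_supp_module R S) M"
    by (rule lin_ext_lin)
  show "h (single R g) = lin_ext R M (\<lambda>g. h (single R g)) (single R g)" if "g \<in> S" for g
    using lin_ext_single[of "\<lambda>g. h (single R g)"] v that by simp
qed

text \<open>
  A basis is the image of the unit vectors.  It is a set and not a family, so this needs the images of
  different generators to differ, which can fail only over the zero ring; there every module is zero and
  the empty set is a basis.
\<close>

lemma free_if_lin_iso_fin_supp:
  assumes h: "h \<in> lin_iso R (fin_supp_module R S) M"
  shows "free_module R M"
proof (cases "\<one>\<^bsub>R\<^esub> = \<zero>\<^bsub>R\<^esub>")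
  case True
  have "x = \<zero>\<^bsub>M\<^esub>" if "x \<in> carrier M" for x
    using smult_one[OF that] smult_l_null[OF that] True by simp
  then have "is_basis R M {}" by (auto simp: is_basis_def)
  then show ?thesis using left_module_axioms by (auto simp: free_module_def)
next
  case False
  define v where "v = (\<lambda>g. h (single R g))"
  have lin: "h \<in> lin_map R (fin_supp_module R S) M"
    and bij: "bij_betw h (carrier (fin_supp_module R S)) (carrier M)"
    using h by (auto simp: lin_iso_def)
  have vM: "v g \<in> carrier M" if "g \<in> S" for g
    using lin_mapD(1)[OF lin R.single_closed[OF that]] by (simp add: v_def)
  have inj: "inj_on v S"
  proof (rule inj_onI)
    fix x y assume xy: "x \<in> S" "y \<in> S" "v x = v y"
    then have "single R x = single R y"
      using bij R.single_closed[OF xy(1)] R.single_closed[OF xy(2)]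
      by (auto simp: v_def bij_betw_def inj_on_def)
    then show "x = y" using False by (auto simp: single_def fun_eq_iff split: if_splits)
  qed
  \<comment> \<open>Coefficient families on the basis and on the generators correspond by \<open>pull\<close>.  Its values
    outside \<open>S\<close> are zero, whereas families on the basis are undefined outside the basis.\<close>
  define pull where "pull c g = (if g \<in> S then c (v g) else \<zero>\<^bsub>R\<^esub>)" for c g
  have supp: "{b \<in> v ` S. c b \<noteq> \<zero>\<^bsub>R\<^esub>} = v ` {g. pull c g \<noteq> \<zero>\<^bsub>R\<^esub>}" for c
    by (auto simp: pull_def)
  have inj_supp: "inj_on v {g. pull c g \<noteq> \<zero>\<^bsub>R\<^esub>}" for c
    by (rule inj_on_subset[OF inj]) (auto simp: pull_def)
  have pull: "pull c \<in> carrier (fin_supp_module R S)"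
    and sum: "(\<Oplus>\<^bsub>M\<^esub>b\<in>{b \<in> v ` S. c b \<noteq> \<zero>\<^bsub>R\<^esub>}. c b \<odot>\<^bsub>M\<^esub> b) = h (pull c)"
    if c: "c \<in> v ` S \<rightarrow>\<^sub>E carrier R" "finite {b \<in> v ` S. c b \<noteq> \<zero>\<^bsub>R\<^esub>}" for c
  proof -
    show pc: "pull c \<in> carrier (fin_supp_module R S)"
      using c finite_imageD[OF _ inj_supp] unfolding supp
      by (auto simp: fin_supp_carrier) (auto simp: pull_def split: if_splits)
    have cM: "c (v g) \<odot>\<^bsub>M\<^esub> v g \<in> carrier M" if "g \<in> S" for g
      using c(1) that by (intro smult_closed vM) auto
    have "(\<Oplus>\<^bsub>M\<^esub>b\<in>{b \<in> v ` S. c b \<noteq> \<zero>\<^bsub>R\<^esub>}. c b \<odot>\<^bsub>M\<^esub> b)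
        = (\<Oplus>\<^bsub>M\<^esub>g\<in>{g. pull c g \<noteq> \<zero>\<^bsub>R\<^esub>}. c (v g) \<odot>\<^bsub>M\<^esub> v g)"
      unfolding supp using c(1)
      by (intro M.finsum_reindex inj_supp)
        (auto simp: pull_def cM split: if_splits)
    also have "\<dots> = lin_ext R M v (pull c)"
      unfolding lin_ext_def using c(1)
      by (intro M.finsum_cong') (auto simp: pull_def cM split: if_splits)
    also have "\<dots> = h (pull c)"
      using lin_map_eq_lin_ext[OF lin pc] by (simp add: v_def)
    finally show "(\<Oplus>\<^bsub>M\<^esub>b\<in>{b \<in> v ` S. c b \<noteq> \<zero>\<^bsub>R\<^esub>}. c b \<odot>\<^bsub>M\<^esub> b) = h (pull c)" .
  qed
  have "is_basis R M (v ` S)"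
    unfolding is_basis_def
  proof (intro conjI ballI)
    show "v ` S \<subseteq> carrier M" using vM by auto
    fix x assume "x \<in> carrier M"
    then have "x \<in> h ` carrier (fin_supp_module R S)" using bij_betw_imp_surj_on[OF bij] by simp
    then obtain c0 where c0: "c0 \<in> carrier (fin_supp_module R S)" "h c0 = x" by (elim imageE) simp
    define c where "c = (\<lambda>b\<in>v ` S. c0 (the_inv_into S v b))"
    have pc: "pull c = c0"
      using c0 by (auto simp: pull_def c_def fun_eq_iff the_inv_into_f_f[OF inj] fin_supp_carrier)
    show "\<exists>!c. c \<in> v ` S \<rightarrow>\<^sub>E carrier R \<and> finite {b \<in> v ` S. c b \<noteq> \<zero>\<^bsub>R\<^esub>} \<and>
       x = (\<Oplus>\<^bsub>M\<^esub>b\<in>{b \<in> v ` S. c b \<noteq> \<zero>\<^bsub>R\<^esub>}. c b \<odot>\<^bsub>M\<^esub> b)"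
    proof (rule ex1I[of _ c])
      have "c \<in> v ` S \<rightarrow>\<^sub>E carrier R" using c0 by (auto simp: c_def fin_supp_carrier)
      moreover have "finite {b \<in> v ` S. c b \<noteq> \<zero>\<^bsub>R\<^esub>}"
        unfolding supp pc using c0 by (auto simp: fin_supp_carrier)
      ultimately show "c \<in> v ` S \<rightarrow>\<^sub>E carrier R \<and> finite {b \<in> v ` S. c b \<noteq> \<zero>\<^bsub>R\<^esub>} \<and>
         x = (\<Oplus>\<^bsub>M\<^esub>b\<in>{b \<in> v ` S. c b \<noteq> \<zero>\<^bsub>R\<^esub>}. c b \<odot>\<^bsub>M\<^esub> b)"
        using sum[of c] pc c0 by simp
    next
      fix d assume d: "d \<in> v ` S \<rightarrow>\<^sub>E carrier R \<and> finite {b \<in> v ` S. d b \<noteq> \<zero>\<^bsub>R\<^esub>} \<and>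
         x = (\<Oplus>\<^bsub>M\<^esub>b\<in>{b \<in> v ` S. d b \<noteq> \<zero>\<^bsub>R\<^esub>}. d b \<odot>\<^bsub>M\<^esub> b)"
      then have "h (pull d) = h c0" using sum[of d] c0 by simp
      then have eq: "pull d = pull c"
        using pull[of d] d c0 bij pc by (auto simp: bij_betw_def inj_on_def)
      show "d = c"
      proof (rule extensionalityI[of _ "v ` S"])
        show "d b = c b" if "b \<in> v ` S" for b
        proof -
          obtain g where "g \<in> S" "b = v g" using \<open>b \<in> v ` S\<close> by auto
          then show ?thesis using fun_cong[OF eq, of g] by (simp add: pull_def)
        qed
      qed (use d in \<open>auto simp: c_def PiE_def\<close>)
    qed
  qed
  then show ?thesis using left_module_axioms by (auto simp: free_module_def)
qed

end

text \<open>
  Dividing by the functions supported in \<open>T\<close> leaves the coordinates outside \<open>T\<close>: the functions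
  supported in \<open>S - T\<close> are a complement, so they map isomorphically onto the quotient.
\<close>

lemma (in ring) free_fin_supp_quotient:
  assumes TS: "T \<subseteq> S"
  shows "free_module R (quot_module (fin_supp_module R S) (carrier (fin_supp_module R T)))"
proof -
  let ?S = "fin_supp_module R S" and ?T = "carrier (fin_supp_module R T)"
    and ?D = "fin_supp_module R (S - T)"
  interpret S: left_module R ?S by (rule fin_supp_left_module)
  have T: "submodule ?T R ?S" using fin_supp_submodule TS .
  interpret T: submodule ?T R ?S by fact
  have D: "submodule (carrier ?D) R ?S" by (rule fin_supp_submodule) auto
  interpret D: submodule "carrier ?D" R ?S by fact
  interpret Q: left_module R "quot_module ?S ?T" by (rule S.quot_left_module[OF T])
  let ?p = "\<lambda>c. ?T +>\<^bsub>?S\<^esub> c"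
  have DS: "carrier ?D \<subseteq> carrier ?S" using D.subset by simp
  have "?p \<in> lin_map R ?D (quot_module ?S ?T)"
    using lin_map_restrict[OF S.quot_proj_lin[OF T] DS] by simp
  moreover have "inj_on ?p (carrier ?D)"
  proof (rule inj_onI)
    fix c d assume cd: "c \<in> carrier ?D" "d \<in> carrier ?D" "?p c = ?p d"
    then have "c \<ominus>\<^bsub>?S\<^esub> d \<in> ?T" using S.coset_eq_iff[OF T] DS by blast
    moreover have "c \<ominus>\<^bsub>?S\<^esub> d \<in> carrier ?D"
      using cd D.m_closed[of c] D.m_inv_closed[of d] by (simp add: a_minus_def a_inv_def)
    ultimately have "c \<ominus>\<^bsub>?S\<^esub> d = \<zero>\<^bsub>?S\<^esub>" by (auto simp: fin_supp_carrier)
    then have "\<ominus>\<^bsub>?S\<^esub> (\<ominus>\<^bsub>?S\<^esub> d) = c"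
      using cd DS by (intro S.minus_equality) (auto simp: a_minus_def)
    then show "c = d" using cd DS by (auto simp: subset_iff)
  qed
  moreover have "?p ` carrier ?D = carrier (quot_module ?S ?T)"
  proof
    show "?p ` carrier ?D \<subseteq> carrier (quot_module ?S ?T)"
      using DS by (auto simp: quot_module_simps)
    show "carrier (quot_module ?S ?T) \<subseteq> ?p ` carrier ?D"
    proof
      fix X assume "X \<in> carrier (quot_module ?S ?T)"
      then obtain c where c: "c \<in> carrier ?S" "X = ?p c" by (auto simp: quot_module_simps)
      \<comment> \<open>Split \<open>c\<close> into its coordinates inside and outside \<open>T\<close>.\<close>
      define t d where "t = (\<lambda>g. if g \<in> T then c g else \<zero>)" and "d = (\<lambda>g. if g \<in> T then \<zero> else c g)"
      have fin: "finite {g. c g \<noteq> \<zero>}" using c by (simp add: fin_supp_carrier)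
      have t: "t \<in> ?T" and d: "d \<in> carrier ?D"
        using c by (auto simp: fin_supp_carrier t_def d_def intro: finite_subset[OF _ fin]
            split: if_splits)
      have "c = t \<oplus>\<^bsub>?S\<^esub> d" using c by (auto simp: t_def d_def fin_supp_carrier)
      then have "?p c = ?p t \<oplus>\<^bsub>quot_module ?S ?T\<^esub> ?p d"
        using S.quot_add[OF T, of t d] t d DS T.subset by auto
      also have "?p t = \<zero>\<^bsub>quot_module ?S ?T\<^esub>"
        using S.coset_eq_self_iff[OF T, of t] t T.subset by (auto simp: quot_module_simps)
      finally have "X = ?p d"
        using c(2) d DS Q.l_zero[of "?p d"] by (auto simp: quot_module_simps)
      then show "X \<in> ?p ` carrier ?D" using d by blast
    qed
  qed
  ultimately have "?p \<in> lin_iso R ?D (quot_module ?S ?T)"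
    by (simp add: lin_iso_def bij_betw_def)
  then show ?thesis by (rule Q.free_if_lin_iso_fin_supp)
qed

lemma (in ring) lin_map_into_submodule:
  assumes M: "left_module R M" and H: "submodule H R M"
    and f: "f \<in> lin_map R (fin_supp_module R S) M"
    and gen: "\<And>g. g \<in> S \<Longrightarrow> f (single R g) \<in> H"
  shows "f \<in> lin_map R (fin_supp_module R S) (M\<lparr>carrier := H\<rparr>)"
proof -
  have "f c \<in> H" if "c \<in> carrier (fin_supp_module R S)" for c
    using that
  proof (induction rule: fin_supp_induct)
    case zero
    show ?case
      using lin_map_zero[OF fin_supp_left_module M f] submodule_zero[OF H] by simp
  next
    case (add a g c)
    have s: "single R g \<in> carrier (fin_supp_module R S)" by (rule single_closed[OF add(2)])
    have "f (\<lambda>h. a \<otimes> single R g h \<oplus> c h) = a \<odot>\<^bsub>M\<^esub> f (single R g) \<oplus>\<^bsub>M\<^esub> f c"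
      using lin_mapD(2)[OF f fin_supp_smult_closed[OF add(1) s] add(3)] lin_mapD(3)[OF f add(1) s]
      by simp
    then show ?case
      using submodule_add[OF H submodule.smult_closed[OF H add(1) gen[OF add(2)]] add(4)] by simp
  qed
  then show ?thesis using f by (auto simp: lin_map_def)
qed

text \<open>
  A finite support that lies in the union of an increasing sequence lies in one of its members.
\<close>

lemma fin_supp_directed_union:
  assumes mono: "\<And>k. S k \<subseteq> S (Suc k)"
  shows "carrier (fin_supp_module R (\<Union>k. S k)) = (\<Union>k. carrier (fin_supp_module R (S k)))"
proof
  show "(\<Union>k. carrier (fin_supp_module R (S k))) \<subseteq> carrier (fin_supp_module R (\<Union>k. S k))"
    by (intro UN_least fin_supp_mono) auto
  have "\<exists>k. A \<subseteq> S k" if "finite A" "A \<subseteq> (\<Union>k. S k)" for A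
    using that
  proof (induction A rule: finite_induct)
    case (insert x A)
    then obtain k l where "A \<subseteq> S k" "x \<in> S l" by auto
    moreover have "S k \<subseteq> S (max k l)" "S l \<subseteq> S (max k l)"
      using lift_Suc_mono_le[of S] mono by auto
    ultimately show ?case by blast
  qed simp
  then show "carrier (fin_supp_module R (\<Union>k. S k)) \<subseteq> (\<Union>k. carrier (fin_supp_module R (S k)))"
    unfolding fin_supp_module_def by fastforce
qed

section \<open>Kernels, images and cohomology of N-complexes\<close>

lemma diff_pow_add:
  "diff_pow X i (s + r) x = diff_pow X (i + int s) r (diff_pow X i s x)"
  by (induction r) (simp_all add: add.assoc)

lemma n_complexD:
  assumes "n_complex R N X"
  shows "left_module R (obj X i)" "diff X i \<in> lin_map R (obj X i) (obj X (i + 1))"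
    "x \<in> carrier (obj X i) \<Longrightarrow> diff_pow X i N x = \<zero>\<^bsub>obj X (i + int N)\<^esub>"
  using assms by (auto simp: n_complex_def)

lemma diff_pow_lin:
  assumes "n_complex R N X"
  shows "diff_pow X i r \<in> lin_map R (obj X i) (obj X (i + int r))"
proof (induction r)
  case 0
  show ?case by (auto simp: lin_map_def)
next
  case (Suc r)
  show ?case
    using lin_map_comp[OF Suc n_complexD(2)[OF assms]] by (simp add: add.assoc add.commute[of 1])
qed

lemma diff_pow_lin_into:
  assumes "n_complex R N X"
  shows "diff_pow X (i - int r) r \<in> lin_map R (obj X (i - int r)) (obj X i)"
  using diff_pow_lin[OF assms, of "i - int r" r] by simp

lemma ker_pow_submodule:
  assumes "n_complex R N X"
  shows "submodule (ker_pow X i r) R (obj X i)"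
  unfolding ker_pow_def
  by (intro lin_map_kernel_submodule n_complexD(1)[OF assms] diff_pow_lin[OF assms])

lemma im_pow_submodule:
  assumes "n_complex R N X"
  shows "submodule (im_pow X i r) R (obj X i)"
  unfolding im_pow_def
  by (intro lin_map_image_submodule n_complexD(1)[OF assms] diff_pow_lin_into[OF assms])

lemma ker_pow_iff:
  "x \<in> ker_pow X i r \<longleftrightarrow> x \<in> carrier (obj X i) \<and> diff_pow X i r x = \<zero>\<^bsub>obj X (i + int r)\<^esub>"
  by (auto simp: ker_pow_def a_kernel_def')

lemma im_pow_subset_ker_pow:
  assumes X: "n_complex R N X" and "r \<le> N"
  shows "im_pow X i (N - r) \<subseteq> ker_pow X i r"
proof
  define j where "j = i - int (N - r)"
  fix z assume "z \<in> im_pow X i (N - r)"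
  then obtain x where x: "x \<in> carrier (obj X j)" "z = diff_pow X j (N - r) x"
    by (auto simp: im_pow_def j_def)
  have i: "i = j + int (N - r)" by (simp add: j_def)
  have "z \<in> carrier (obj X i)"
    using lin_mapD(1)[OF diff_pow_lin[OF X] x(1)] by (simp add: x(2) i)
  moreover have "diff_pow X i r z = diff_pow X j ((N - r) + r) x"
    by (simp only: diff_pow_add x(2) i)
  ultimately show "z \<in> ker_pow X i r"
    using n_complexD(3)[OF X x(1)] \<open>r \<le> N\<close> by (simp add: ker_pow_iff i add.assoc of_nat_diff)
qed

lemma complex_hom_diff_pow:
  assumes "n_complex R N X" and f: "f \<in> complex_hom R X Y" and x: "x \<in> carrier (obj X i)"
  shows "f (i + int r) (diff_pow X i r x) = diff_pow Y i r (f i x)"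
proof (induction r)
  case (Suc r)
  have "diff_pow X i r x \<in> carrier (obj X (i + int r))"
    using lin_mapD(1)[OF diff_pow_lin[OF assms(1)] x] .
  then have "f (i + int r + 1) (diff X (i + int r) (diff_pow X i r x))
      = diff Y (i + int r) (f (i + int r) (diff_pow X i r x))"
    using f by (auto simp: complex_hom_def)
  then show ?case using Suc by (simp add: add.assoc add.commute[of 1])
qed simp

text \<open>
  Surjectivity on kernels makes the induced maps on cohomology surjective.  For injectivity it remains
  that a cycle whose image is a boundary is itself a boundary.
\<close>

lemma n_quasi_isoI:
  assumes X: "n_complex R N X" and Y: "n_complex R N Y" and f: "f \<in> complex_hom R X Y"
    and ker: "\<And>i r. r \<in> {1..N - 1} \<Longrightarrow> f i ` ker_pow X i r = ker_pow Y i r"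
    and refl: "\<And>i r x. \<lbrakk>r \<in> {1..N - 1}; x \<in> ker_pow X i r; f i x \<in> im_pow Y i (N - r)\<rbrakk> \<Longrightarrow>
      x \<in> im_pow X i (N - r)"
  shows "n_quasi_iso R N X Y f"
  unfolding n_quasi_iso_def
proof (intro conjI allI ballI f)
  fix i r assume r: "r \<in> {1..N - 1}"
  then have rN: "r \<le> N" by auto
  let ?A = "(obj X i)\<lparr>carrier := ker_pow X i r\<rparr>" and ?B = "(obj Y i)\<lparr>carrier := ker_pow Y i r\<rparr>"
  have lin: "f i \<in> lin_map R (obj X i) (obj Y i)" using f by (auto simp: complex_hom_def)
  have "coset_map ?B (im_pow Y i (N - r)) (f i)
      \<in> lin_iso R (quot_module ?A (im_pow X i (N - r))) (quot_module ?B (im_pow Y i (N - r)))"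
  proof (rule coset_map_lin_iso)
    show "left_module R ?A" "left_module R ?B"
      by (intro left_module.submodule_left_module n_complexD(1)[OF X] n_complexD(1)[OF Y]
          ker_pow_submodule[OF X] ker_pow_submodule[OF Y])+
    show "submodule (im_pow X i (N - r)) R ?A" "submodule (im_pow Y i (N - r)) R ?B"
      by (intro submodule_of_submodule n_complexD(1)[OF X] n_complexD(1)[OF Y]
          ker_pow_submodule[OF X] ker_pow_submodule[OF Y] im_pow_submodule[OF X]
          im_pow_submodule[OF Y] im_pow_subset_ker_pow[OF X rN] im_pow_subset_ker_pow[OF Y rN])+
    show "f i \<in> lin_map R ?A ?B"
      using lin ker[OF r, of i] by (auto simp: lin_map_def ker_pow_iff image_subset_iff set_eq_iff)
    show "f i ` carrier ?A = carrier ?B" using ker[OF r] by simp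
    fix x assume "x \<in> carrier ?A"
    then have x: "x \<in> ker_pow X i r" by simp
    show "f i x \<in> im_pow Y i (N - r) \<longleftrightarrow> x \<in> im_pow X i (N - r)"
    proof
      assume "x \<in> im_pow X i (N - r)"
      then obtain u where u: "u \<in> carrier (obj X (i - int (N - r)))"
        "x = diff_pow X (i - int (N - r)) (N - r) u" by (auto simp: im_pow_def)
      have "f i x = diff_pow Y (i - int (N - r)) (N - r) (f (i - int (N - r)) u)"
        using complex_hom_diff_pow[OF X f u(1), of "N - r"] by (simp add: u(2))
      moreover have "f (i - int (N - r)) u \<in> carrier (obj Y (i - int (N - r)))"
        using f u(1) by (auto simp: complex_hom_def lin_map_def)
      ultimately show "f i x \<in> im_pow Y i (N - r)" by (auto simp: im_pow_def)
    qed (rule refl[OF r x])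
  qed
  then show "cohom_map N Y f i r \<in> lin_iso R (cohom N X i r) (cohom N Y i r)"
    by (simp add: cohom_def cohom_map_def)
qed

section \<open>The cellular resolution\<close>

text \<open>
  A cell is given by its value \<open>y\<close> under the augmentation and by its boundary \<open>w\<close>, a finitely
  supported function on earlier cells.  Pairs \<open>(y, w)\<close> are of a type that mentions the type of cells, so
  they cannot simply be the cells themselves.  Instead the cells are names of pairs, from a fixed type
  \<open>'g\<close>.  It suffices that every pair has a name; a pair with several names contributes several cells.
\<close>

locale cellular_resolution =
  fixes R :: "('r, 'k) ring_scheme" and N :: nat and M :: "('r, 'm) ncomplex"
    and aug_val :: "'g \<Rightarrow> 'm" and boundary :: "'g \<Rightarrow> 'g \<Rightarrow> 'r"
  assumes ring: "ring R" and M: "n_complex R N M"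
    and every_cell_has_name: "finite {g. w g \<noteq> \<zero>\<^bsub>R\<^esub>} \<Longrightarrow> \<exists>g. aug_val g = y \<and> boundary g = w"
begin

sublocale R?: ring R by (rule ring)

abbreviation Free :: "'g set \<Rightarrow> ('r, 'g \<Rightarrow> 'r) module"
  where "Free S \<equiv> fin_supp_module R S"

text \<open>
  Neither the boundary of a cell nor the operations of the free modules depend on the degree, so one map
  serves as the differential in all degrees.
\<close>

definition D :: "('g \<Rightarrow> 'r) \<Rightarrow> 'g \<Rightarrow> 'r"
  where "D = lin_ext R (Free UNIV) boundary"

definition aug :: "int \<Rightarrow> ('g \<Rightarrow> 'r) \<Rightarrow> 'm"
  where "aug i = lin_ext R (obj M i) aug_val"

text \<open>
  The name of a cell does not record its degree: one name may be used in several degrees, in each of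
  which it denotes a different generator of the complex.

  The condition \<open>D\<^bsup>N - 1\<^esup> w = 0\<close> makes \<open>D\<^sup>N\<close> vanish on the new cell, and \<open>aug w = d y\<close> makes the
  augmentation a chain map.  For \<open>N = 0\<close> only the zero complex is allowed, hence there are no cells;
  the truncated exponent \<open>N - 1\<close> would otherwise admit cells with zero boundary.
\<close>

primrec cells :: "nat \<Rightarrow> int \<Rightarrow> 'g set"
  where
    "cells 0 i = {}"
  | "cells (Suc k) i = {g. 0 < N \<and> aug_val g \<in> carrier (obj M i) \<and>
       boundary g \<in> carrier (Free (cells k (i + 1))) \<and>
       (D ^^ (N - 1)) (boundary g) = (\<lambda>_. \<zero>\<^bsub>R\<^esub>) \<and>
       aug (i + 1) (boundary g) = diff M i (aug_val g)}"

definition all_cells :: "int \<Rightarrow> 'g set"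
  where "all_cells i = (\<Union>k. cells k i)"

definition F :: "('r, 'g \<Rightarrow> 'r) ncomplex"
  where "F = \<lparr>obj = (\<lambda>i. Free (all_cells i)), diff = (\<lambda>i. D)\<rparr>"

lemma F_simps [simp]: "obj F i = Free (all_cells i)" "diff F i = D"
  by (simp_all add: F_def)

lemma cells_mono: "cells k i \<subseteq> cells (Suc k) i"
proof (induction k arbitrary: i)
  case (Suc k)
  show ?case using fin_supp_mono[OF Suc[of "i + 1"], of R] by auto
qed simp

lemma carrier_F: "carrier (Free (all_cells i)) = (\<Union>k. carrier (Free (cells k i)))"
  unfolding all_cells_def by (rule fin_supp_directed_union) (rule cells_mono)

text \<open>
  This is what makes the filtration by stages semifree: the differential lowers the stage.
\<close>

lemma cell_boundary_lower:
  "g \<in> cells (Suc k) i \<Longrightarrow> boundary g \<in> carrier (Free (cells k (i + 1)))"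
  by simp

lemma cell_boundary_same:
  assumes "g \<in> cells k i"
  shows "boundary g \<in> carrier (Free (cells k (i + 1)))"
proof (cases k)
  case (Suc l)
  then show ?thesis
    using cell_boundary_lower[of g l i] fin_supp_mono[OF cells_mono[of l "i + 1"], of R] assms by blast
qed (use assms in simp)

lemma cellE:
  assumes "g \<in> all_cells i"
  shows "0 < N" "aug_val g \<in> carrier (obj M i)" "boundary g \<in> carrier (Free (all_cells (i + 1)))"
    "(D ^^ (N - 1)) (boundary g) = (\<lambda>_. \<zero>\<^bsub>R\<^esub>)"
    "aug (i + 1) (boundary g) = diff M i (aug_val g)"
proof -
  obtain k where "g \<in> cells k i" using assms by (auto simp: all_cells_def)
  then obtain l where g: "g \<in> cells (Suc l) i" by (cases k) auto
  then show "0 < N" "aug_val g \<in> carrier (obj M i)" "(D ^^ (N - 1)) (boundary g) = (\<lambda>_. \<zero>\<^bsub>R\<^esub>)"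
    "aug (i + 1) (boundary g) = diff M i (aug_val g)" by auto
  show "boundary g \<in> carrier (Free (all_cells (i + 1)))"
    using cell_boundary_lower[OF g] carrier_F by blast
qed

lemma D_lin:
  assumes "\<And>g. g \<in> S \<Longrightarrow> boundary g \<in> carrier (Free T)"
  shows "D \<in> lin_map R (Free S) (Free T)"
    and "g \<in> S \<Longrightarrow> D (single R g) = boundary g"
proof -
  interpret U: left_module R "Free UNIV" by (rule fin_supp_left_module)
  have bU: "boundary g \<in> carrier (Free UNIV)" if "g \<in> S" for g
    using fin_supp_mono[of T UNIV R] assms[OF that] by blast
  have single: "D (single R g) = boundary g" if "g \<in> S" for g
    unfolding D_def by (rule U.lin_ext_single[of boundary]) (rule bU[OF that])
  then show "g \<in> S \<Longrightarrow> D (single R g) = boundary g" .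
  have "D \<in> lin_map R (Free S) (Free UNIV)"
    unfolding D_def by (rule U.lin_ext_lin[OF bU])
  then have "D \<in> lin_map R (Free S) ((Free UNIV)\<lparr>carrier := carrier (Free T)\<rparr>)"
    using single assms
    by (intro lin_map_into_submodule fin_supp_left_module fin_supp_submodule) auto
  then show "D \<in> lin_map R (Free S) (Free T)" by simp
qed

lemma D_F_lin: "D \<in> lin_map R (Free (all_cells i)) (Free (all_cells (i + 1)))"
  and D_F_single: "g \<in> all_cells i \<Longrightarrow> D (single R g) = boundary g"
  by (rule D_lin[OF cellE(3)]; assumption)+

lemma aug_lin: "aug i \<in> lin_map R (Free (all_cells i)) (obj M i)"
  and aug_single: "g \<in> all_cells i \<Longrightarrow> aug i (single R g) = aug_val g"
  unfolding aug_def
  by (auto intro: left_module.lin_ext_lin left_module.lin_ext_single n_complexD(1)[OF M] cellE(2))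

lemma aug_D:
  assumes c: "c \<in> carrier (Free (all_cells i))"
  shows "aug (i + 1) (D c) = diff M i (aug i c)"
  by (rule lin_map_eq_on_singles[OF n_complexD(1)[OF M]
        lin_map_comp[OF D_F_lin aug_lin] lin_map_comp[OF aug_lin n_complexD(2)[OF M]] _ c])
    (simp add: D_F_single aug_single cellE(5))

lemma aug_hom: "aug \<in> complex_hom R F M"
  using aug_lin aug_D by (simp add: complex_hom_def)

lemma diff_pow_F: "diff_pow F i r c = (D ^^ r) c"
  by (induction r) simp_all

lemma D_pow_lin: "(D ^^ r) \<in> lin_map R (Free (all_cells i)) (Free (all_cells (i + int r)))"
proof (induction r)
  case 0
  show ?case by (auto simp: lin_map_def)
next
  case (Suc r)
  show ?case using lin_map_comp[OF Suc D_F_lin] by (simp add: add.assoc add.commute[of 1] comp_def)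
qed

text \<open>
  It suffices to look at a single cell, whose boundary is annihilated by \<open>D\<^bsup>N - 1\<^esup>\<close> by construction.
\<close>

lemma D_pow_N:
  assumes c: "c \<in> carrier (Free (all_cells i))"
  shows "(D ^^ N) c = (\<lambda>_. \<zero>\<^bsub>R\<^esub>)"
proof -
  have "(D ^^ N) (single R g) = (\<lambda>_. \<zero>\<^bsub>R\<^esub>)" if g: "g \<in> all_cells i" for g
  proof -
    have "(D ^^ N) (single R g) = (D ^^ (N - 1)) (D (single R g))"
      using cellE(1)[OF g] by (cases N) (simp_all add: funpow_swap1)
    then show ?thesis using cellE(4)[OF g] D_F_single[OF g] by simp
  qed
  then show ?thesis
    using lin_map_eq_on_singles[OF fin_supp_left_module D_pow_lin
        lin_map_const_zero[OF fin_supp_left_module] _ c] by simp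
qed

lemma F_n_complex: "n_complex R N F"
  by (simp add: n_complex_def fin_supp_left_module D_F_lin diff_pow_F D_pow_N)

text \<open>
  The property for which the complex is built: whenever the compatibility conditions for a cell with
  boundary \<open>w\<close> and value \<open>y\<close> hold, this cell exists.  Since \<open>w\<close> has finite support, it lives at a finite
  stage, and the cell is attached at the next one.
\<close>

lemma lift_step:
  assumes "0 < N" and y: "y \<in> carrier (obj M i)" and w: "w \<in> carrier (Free (all_cells (i + 1)))"
    and "(D ^^ (N - 1)) w = (\<lambda>_. \<zero>\<^bsub>R\<^esub>)" and "aug (i + 1) w = diff M i y"
  obtains e where "e \<in> carrier (Free (all_cells i))" "D e = w" "aug i e = y"
proof -
  obtain k where k: "w \<in> carrier (Free (cells k (i + 1)))" using w carrier_F by blast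
  obtain g where g: "aug_val g = y" "boundary g = w"
    using every_cell_has_name[of w y] w by (auto simp: fin_supp_carrier)
  then have "g \<in> cells (Suc k) i" using assms k by simp
  then have "g \<in> all_cells i" unfolding all_cells_def by blast
  then show ?thesis
    using that[of "single R g"] single_closed[of g "all_cells i"] D_F_single[of g i] aug_single[of g i] g
    by simp
qed

text \<open>
  Lifting \<open>y\<close> together with the equation \<open>d\<^sup>s y = aug z\<close>.  The elements \<open>d\<^bsup>s - 1\<^esup> y, \<dots>, d y, y\<close> are lifted one
  after the other, each with the preceding lift as its boundary.  If \<open>D\<^sup>r z = 0\<close> then the \<open>j\<close>-th lift is
  annihilated by \<open>D\<^bsup>r + j\<^esup>\<close>; as \<open>r + j < N\<close> until the last one, the next cell is always available.

  Both halves of the quasi-isomorphism are instances: \<open>z = 0\<close> lifts a cycle to a cycle, and \<open>s = N - r\<close>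
  shows that a cycle over a boundary is a boundary.
\<close>

lemma lift_cycle:
  assumes "z \<in> carrier (Free (all_cells (i + int s)))" "(D ^^ r) z = (\<lambda>_. \<zero>\<^bsub>R\<^esub>)" "r + s \<le> N"
    and y: "y \<in> carrier (obj M i)" and "aug (i + int s) z = diff_pow M i s y"
  shows "\<exists>e\<in>carrier (Free (all_cells i)). (D ^^ s) e = z \<and> aug i e = y"
  using assms(1-3,5)
proof (induction s arbitrary: r z)
  case 0
  then show ?case by auto
next
  case (Suc s)
  have z: "z \<in> carrier (Free (all_cells (i + int s + 1)))"
    using Suc.prems(1) by (simp add: add.assoc add.commute[of 1])
  have az: "aug (i + int s + 1) z = diff M (i + int s) (diff_pow M i s y)"
    using Suc.prems(4) by (simp add: add.assoc add.commute[of 1])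
  \<comment> \<open>Lift \<open>d\<^sup>s y\<close> over \<open>z\<close> first; this raises \<open>r\<close> by one, and the induction lifts \<open>y\<close> itself.\<close>
  have N: "N - 1 = (N - 1 - r) + r" using Suc.prems(3) by simp
  have "(D ^^ (N - 1)) z = (D ^^ (N - 1 - r)) (\<lambda>_. \<zero>\<^bsub>R\<^esub>)"
    by (subst N) (simp only: funpow_add comp_apply Suc.prems(2))
  also have "\<dots> = (\<lambda>_. \<zero>\<^bsub>R\<^esub>)"
    using lin_map_zero[OF fin_supp_left_module fin_supp_left_module D_pow_lin] by simp
  finally obtain w where w: "w \<in> carrier (Free (all_cells (i + int s)))" "D w = z"
      "aug (i + int s) w = diff_pow M i s y"
    using lift_step[OF _ lin_mapD(1)[OF diff_pow_lin[OF M] y] z _ az] Suc.prems(3) by auto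
  have "(D ^^ Suc r) w = (\<lambda>_. \<zero>\<^bsub>R\<^esub>)"
    using Suc.prems(2) w(2) by (simp add: funpow_swap1)
  then obtain e where "e \<in> carrier (Free (all_cells i))" "(D ^^ s) e = w" "aug i e = y"
    using Suc.IH[OF w(1) _ _ w(3), of "Suc r"] Suc.prems(3) by auto
  then show ?case using w(2) by auto
qed

text \<open>
  Besides cycles this covers all elements, as \<open>d\<^sup>N = 0\<close> on the resolved complex.
\<close>

lemma lift_kernel:
  assumes "r \<le> N" and y: "y \<in> carrier (obj M i)" and "diff_pow M i r y = \<zero>\<^bsub>obj M (i + int r)\<^esub>"
  shows "\<exists>e\<in>carrier (Free (all_cells i)). (D ^^ r) e = (\<lambda>_. \<zero>\<^bsub>R\<^esub>) \<and> aug i e = y"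
proof (rule lift_cycle[where r = 0])
  show "aug (i + int r) (\<lambda>_. \<zero>\<^bsub>R\<^esub>) = diff_pow M i r y"
    using lin_map_zero[OF fin_supp_left_module n_complexD(1)[OF M] aug_lin] assms(3) by simp
qed (use assms in \<open>auto simp: fin_supp_zero\<close>)

lemma aug_surj: "aug i ` carrier (obj F i) = carrier (obj M i)"
proof
  show "aug i ` carrier (obj F i) \<subseteq> carrier (obj M i)" using lin_mapD(1)[OF aug_lin] by auto
  show "carrier (obj M i) \<subseteq> aug i ` carrier (obj F i)"
  proof
    fix y assume y: "y \<in> carrier (obj M i)"
    show "y \<in> aug i ` carrier (obj F i)"
      using lift_kernel[OF order_refl y n_complexD(3)[OF M y]] by auto
  qed
qed

lemma aug_ker_surj:
  assumes "r \<le> N"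
  shows "aug i ` ker_pow F i r = ker_pow M i r"
proof
  show "aug i ` ker_pow F i r \<subseteq> ker_pow M i r"
  proof
    fix y assume "y \<in> aug i ` ker_pow F i r"
    then obtain c where c: "c \<in> carrier (obj F i)" "diff_pow F i r c = (\<lambda>_. \<zero>\<^bsub>R\<^esub>)" "y = aug i c"
      by (auto simp: ker_pow_iff)
    have "aug (i + int r) (\<lambda>_. \<zero>\<^bsub>R\<^esub>) = diff_pow M i r y"
      using complex_hom_diff_pow[OF F_n_complex aug_hom c(1), of r] c by simp
    then show "y \<in> ker_pow M i r"
      using lin_map_zero[OF fin_supp_left_module n_complexD(1)[OF M] aug_lin]
        lin_mapD(1)[OF aug_lin] c by (simp add: ker_pow_iff)
  qed
  show "ker_pow M i r \<subseteq> aug i ` ker_pow F i r"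
  proof
    fix y assume "y \<in> ker_pow M i r"
    then show "y \<in> aug i ` ker_pow F i r"
      using lift_kernel[OF assms, of y i] by (auto simp: ker_pow_iff diff_pow_F)
  qed
qed

lemma aug_quasi_iso: "n_quasi_iso R N F M aug"
proof (rule n_quasi_isoI[OF F_n_complex M aug_hom])
  show "aug i ` ker_pow F i r = ker_pow M i r" if "r \<in> {1..N - 1}" for i r
    using that by (intro aug_ker_surj) auto
  fix i r z assume r: "r \<in> {1..N - 1}" and z: "z \<in> ker_pow F i r" "aug i z \<in> im_pow M i (N - r)"
  define j where "j = i - int (N - r)"
  have i: "i = j + int (N - r)" by (simp add: j_def)
  obtain y where y: "y \<in> carrier (obj M j)" "aug i z = diff_pow M j (N - r) y"
    using z(2) by (auto simp: im_pow_def j_def)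
  have "\<exists>e\<in>carrier (Free (all_cells j)). (D ^^ (N - r)) e = z \<and> aug j e = y"
    using z(1) y r unfolding i
    by (intro lift_cycle[where r = r]) (auto simp: ker_pow_iff diff_pow_F)
  then show "z \<in> im_pow F i (N - r)"
    by (auto simp: im_pow_def diff_pow_F simp flip: j_def)
qed

lemma F_semifree: "semifree R N F"
  unfolding semifree_def
proof (intro conjI exI allI impI F_n_complex)
  let ?Fil = "\<lambda>k i. carrier (Free (cells k i))"
  have sub: "cells k i \<subseteq> all_cells i" for k i by (auto simp: all_cells_def)
  note D_cells = D_lin[OF cell_boundary_same]
  show "subcomplex R F (?Fil k)" for k
    using lin_mapD(1)[OF D_cells(1)] fin_supp_submodule[OF sub] by (auto simp: subcomplex_def)
  show "?Fil 0 i = {\<zero>\<^bsub>obj F i\<^esub>}" for i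
    by (auto simp: fin_supp_carrier fun_eq_iff)
  show "?Fil k i \<subseteq> ?Fil (Suc k) i" for k i
    by (rule fin_supp_mono[OF cells_mono])
  show "carrier (obj F i) = (\<Union>k. ?Fil k i)" for i
    using carrier_F by simp
  fix k :: nat assume "1 \<le> k"
  then obtain l where k: "k = Suc l" by (cases k) auto
  have obj: "obj (quot_complex (restrict_complex F (?Fil k)) (?Fil (k - 1))) i
      = quot_module (Free (cells (Suc l) i)) (?Fil l i)" for i
    by (simp add: quot_complex_def restrict_complex_def k)
  have dif: "diff (quot_complex (restrict_complex F (?Fil k)) (?Fil (k - 1))) i
      = coset_map (Free (cells (Suc l) (i + 1))) (?Fil l (i + 1)) D" for i
    by (simp add: quot_complex_def restrict_complex_def k)
  show "free_zero_diff R (quot_complex (restrict_complex F (?Fil k)) (?Fil (k - 1)))"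
    unfolding free_zero_diff_def obj dif
  proof (intro conjI allI ballI free_fin_supp_quotient cells_mono)
    fix i X assume "X \<in> carrier (quot_module (Free (cells (Suc l) i)) (?Fil l i))"
    then obtain c where c: "c \<in> ?Fil (Suc l) i" "X = ?Fil l i +>\<^bsub>Free (cells (Suc l) i)\<^esub> c"
      by (auto simp: quot_module_simps)
    let ?B = "Free (cells (Suc l) (i + 1))"
    have K: "submodule (?Fil l (i + 1)) R ?B" by (rule fin_supp_submodule[OF cells_mono])
    have Dc: "D c \<in> ?Fil l (i + 1)" by (rule lin_mapD(1)[OF D_lin(1)[OF cell_boundary_lower] c(1)])
    have "coset_map ?B (?Fil l (i + 1)) D X = ?Fil l (i + 1) +>\<^bsub>?B\<^esub> D c"
      unfolding c(2) using lin_mapD(1)[OF D_cells(1)]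
      by (intro coset_map_lin[OF fin_supp_left_module fin_supp_left_module
            fin_supp_submodule[OF cells_mono] K D_cells(1) _ c(1)]) auto
    also have "\<dots> = ?Fil l (i + 1)"
      using left_module.coset_eq_self_iff[OF fin_supp_left_module K] Dc
        fin_supp_mono[OF cells_mono] by blast
    finally show "coset_map ?B (?Fil l (i + 1)) D X = \<zero>\<^bsub>quot_module ?B (?Fil l (i + 1))\<^esub>"
      by (simp add: quot_module_simps)
  qed
qed

end

section \<open>Words as names of cells\<close>

text \<open>
  A list of pairs is written as one word by putting in front of every pair the length of its first
  component, which tells where that component ends.
\<close>

fun pack :: "(('r + 'm + int) list \<times> 'r) list \<Rightarrow> ('r + 'm + int) list"
  where
    "pack [] = []"
  | "pack ((g, a) # ps) = Inr (Inr (int (length g))) # Inl a # g @ pack ps"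

lemma pack_inj: "pack ps = pack qs \<Longrightarrow> ps = qs"
proof (induction ps arbitrary: qs rule: pack.induct)
  case 1
  then show ?case by (cases qs rule: pack.cases) auto
next
  case (2 g a ps)
  then show ?case by (cases qs rule: pack.cases) auto
qed

text \<open>
  A finitely supported function is the lookup function of a finite association list, and this list,
  preceded by the value \<open>y\<close>, is coded as a word.  Each order of the support gives a name of \<open>(y, w)\<close>.
\<close>

lemma cells_named_by_words:
  fixes z :: 'r
  obtains v :: "('r + 'm + int) list \<Rightarrow> 'm" and b :: "('r + 'm + int) list \<Rightarrow> ('r + 'm + int) list \<Rightarrow> 'r"
  where "\<And>w y. finite {g. w g \<noteq> z} \<Longrightarrow> \<exists>g. v g = y \<and> b g = w"
proof -
  define code where "code = (\<lambda>(y :: 'm, ps). Inr (Inl y) # pack ps :: ('r + 'm + int) list)"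
  define lookup where "lookup ps g = (case map_of ps g of None \<Rightarrow> z | Some a \<Rightarrow> a)"
    for ps :: "(('r + 'm + int) list \<times> 'r) list" and g
  have inj: "inj code" by (auto simp: code_def inj_on_def dest: pack_inj)
  show ?thesis
  proof (rule that[of "\<lambda>g. fst (inv_into UNIV code g)" "\<lambda>g. lookup (snd (inv_into UNIV code g))"])
    fix w :: "('r + 'm + int) list \<Rightarrow> 'r" and y :: 'm
    assume "finite {g. w g \<noteq> z}"
    then obtain gs where gs: "set gs = {g. w g \<noteq> z}" using finite_list by blast
    define ps where "ps = map (\<lambda>g. (g, w g)) gs"
    have "lookup ps = w"
      using gs by (auto simp: lookup_def ps_def map_of_map_restrict restrict_map_def fun_eq_iff)
    then show "\<exists>g. fst (inv_into UNIV code g) = y \<and> lookup (snd (inv_into UNIV code g)) = w"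
      by (intro exI[of _ "code (y, ps)"]) (simp add: inv_into_f_f[OF inj])
  qed
qed

theorem theorem7p25:
  fixes R :: "('r, 'k) ring_scheme" and N :: nat and M :: "('r, 'm) ncomplex"
  assumes "ring R" and "n_complex R N M"
  shows "\<exists>(F :: ('r, ('r, 'm) resolution_elem) ncomplex) f.
           semifree R N F \<and> f \<in> complex_hom R F M \<and> n_quasi_iso R N F M f \<and>
           (\<forall>i. f i ` carrier (obj F i) = carrier (obj M i)) \<and>
           (\<forall>i. \<forall>r\<in>{1..N - 1}. f i ` ker_pow F i r = ker_pow M i r)"
proof -
  obtain v :: "('r + 'm + int) list \<Rightarrow> 'm" and b :: "('r + 'm + int) list \<Rightarrow> ('r, 'm) resolution_elem"
    where "\<And>w y. finite {g. w g \<noteq> \<zero>\<^bsub>R\<^esub>} \<Longrightarrow> \<exists>g. v g = y \<and> b g = w"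
    using cells_named_by_words[where z = "\<zero>\<^bsub>R\<^esub>"] by blast
  then interpret C: cellular_resolution R N M v b
    by (intro cellular_resolution.intro assms)
  have "C.aug i ` ker_pow C.F i r = ker_pow M i r" if "r \<in> {1..N - 1}" for i r
    using that by (intro C.aug_ker_surj) auto
  then show ?thesis
    using C.F_semifree C.aug_hom C.aug_quasi_iso C.aug_surj by blast
qed

end
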